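(* Let $c \ge 1$ and $d \ge 0$ be integers and let $G$ be a graph on $n$ vertices which is the complement of a $c$-closed graph. Then the number of inclusion-maximal sets $S \subseteq V(G)$ such that $G[S]$ has maximum degree at most $d$ is at most $2 n^{2d} \cdot \mathcal{M}_d(c-1+2d;\, 2d)$. Moreover, for $d = 1$ this number is at most $2n^2 \cdot \mathcal{M}_1(c-1)$.
   Context: Graphs are finite, simple and undirected. A graph $H$ is $c$-closed if any two non-adjacent vertices of $H$ have at most $c-1$ common neighbors. Equivalently, $G$ is the complement of a $c$-closed graph iff for any two adjacent vertices $u,v$ of $G$, at most $c-1$ vertices of $G$ are adjacent to neither $u$ nor $v$ and different from $u,v$. For integers $d, N, p \ge 0$ and a graph $H$ with $P\subseteq V(H)$, let $\mathcal{M}_d(H;P)$ be the number of inclusion-maximal sets $S\subseteq V(H)$ with $H[S]$ of maximum degree at most $d$ that contain $P$; $\mathcal{M}_d(N+p;\,p)$ is the maximum of $\mathcal{M}_d(H;P)$ over all graphs $H$ on $N+p$ vertices and all $P\subseteq V(H)$ with $|P|=p$. Also $\mathcal{M}_d(N) = \mathcal{M}_d(N;0)$ is the maximum over all $N$-vertex graphs $H$ of the number of inclusion-maximal sets $S$ with $H[S]$ of maximum degree at most $d$.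
   Formalization: The formal theorem assumes d ≥ 1 and n ≥ 1: for d = 0 the bound 2·M_0(c−1) fails for every c (e.g. K_3 with c = 1 has 3 maximal independent sets against 2), and for n = 0, d ≥ 1 the bound is 0 while the empty graph has one maximal set. *)

theory Defs
  imports Main
begin

type_synonym 'a graph = "'a set \<times> 'a set set"

abbreviation verts :: "'a graph \<Rightarrow> 'a set" where "verts G \<equiv> fst G"
abbreviation edges :: "'a graph \<Rightarrow> 'a set set" where "edges G \<equiv> snd G"

definition simple_graph :: "'a graph \<Rightarrow> bool" where
  "simple_graph G \<longleftrightarrow> finite (verts G) \<and> edges G \<subseteq> {e. e \<subseteq> verts G \<and> card e = 2}"

definition complement :: "'a graph \<Rightarrow> 'a graph" where
  "complement G = (verts G, {e. e \<subseteq> verts G \<and> card e = 2} - edges G)"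

definition neighbors :: "'a graph \<Rightarrow> 'a \<Rightarrow> 'a set" where
  "neighbors G v = {w \<in> verts G. {v, w} \<in> edges G}"

(* Meant for c \<ge> 1: the subtraction is on naturals. *)
definition c_closed :: "nat \<Rightarrow> 'a graph \<Rightarrow> bool" where
  "c_closed c G \<longleftrightarrow>
     (\<forall>u\<in>verts G. \<forall>v\<in>verts G. u \<noteq> v \<and> {u, v} \<notin> edges G \<longrightarrow>
        card (neighbors G u \<inter> neighbors G v) \<le> c - 1)"

definition induced :: "'a graph \<Rightarrow> 'a set \<Rightarrow> 'a graph" where
  "induced G S = (S, {e \<in> edges G. e \<subseteq> S})"

definition max_degree_le :: "nat \<Rightarrow> 'a graph \<Rightarrow> bool" where
  "max_degree_le d G \<longleftrightarrow> (\<forall>v\<in>verts G. card (neighbors G v) \<le> d)"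

definition maximal_sets :: "nat \<Rightarrow> 'a graph \<Rightarrow> 'a set set" where
  "maximal_sets d G =
     {S. S \<subseteq> verts G \<and> max_degree_le d (induced G S) \<and>
         (\<forall>T. T \<subseteq> verts G \<and> S \<subset> T \<longrightarrow> \<not> max_degree_le d (induced G T))}"

definition num_maximal :: "nat \<Rightarrow> 'a graph \<Rightarrow> 'a set \<Rightarrow> nat" where
  "num_maximal d G P = card {S \<in> maximal_sets d G. P \<subseteq> S}"

(* The second argument is the total number of vertices, so max_num_maximal d (N + p) p is the
   quantity M_d(N + p; p) and max_num_maximal d N 0 is M_d(N).  The count is invariant under
   isomorphism, and every finite graph has an isomorphic copy with natural numbers as vertices. *)
definition max_num_maximal :: "nat \<Rightarrow> nat \<Rightarrow> nat \<Rightarrow> nat" where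
  "max_num_maximal d m p =
     Max {num_maximal d H P | (H :: nat graph) P.
            simple_graph H \<and> card (verts H) = m \<and> P \<subseteq> verts H \<and> card P = p}"

lemma max_num_maximal_well_defined:
  fixes d m p :: nat
  defines "A \<equiv> {num_maximal d H P | (H :: nat graph) P.
            simple_graph H \<and> card (verts H) = m \<and> P \<subseteq> verts H \<and> card P = p}"
  assumes "p \<le> m"
  shows "finite A" and "A \<noteq> {}"
proof -
  have "num_maximal d H P \<le> 2 ^ m" if "simple_graph H" "card (verts H) = m"
    for H :: "nat graph" and P
  proof -
    have fin: "finite (verts H)" using that by (simp add: simple_graph_def)
    have "num_maximal d H P \<le> card (Pow (verts H))"
      unfolding num_maximal_def using fin
      by (intro card_mono) (auto simp: maximal_sets_def)
    then show ?thesis using fin that by (simp add: card_Pow)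
  qed
  then have "A \<subseteq> {..2 ^ m}" by (auto simp: A_def)
  then show "finite A" by (rule finite_subset) simp
  have "num_maximal d ({..<m}, {}) {..<p} \<in> A"
    unfolding A_def using assms(2)
    by (intro CollectI exI[of _ "({..<m}, {})"] exI[of _ "{..<p}"]) (auto simp: simple_graph_def)
  then show "A \<noteq> {}" by blast
qed

end

theory Submission
  imports Defs "HOL-Library.FuncSet"
begin

text \<open>
  A maximal set containing an edge \<open>uv\<close> consists of the at most \<open>2d\<close> neighbours of \<open>u\<close> or \<open>v\<close> in it
  and of some of the at most \<open>c - 1\<close> common non-neighbours. Independent maximal sets are
  counted by deleting the vertices one at a time, as for maximal cliques of \<open>c\<close>-closed graphs. This
  costs a factor \<open>n ^ (d + 2)\<close>, which is small enough unless \<open>d = 1\<close>. In that case the sets are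
  merely counted as maximal independent sets, and the Moon--Moser theorem shows
  \<open>M\<^sub>0(m) \<le> 3 M\<^sub>1(m)\<close>; since both \<open>M\<^sub>0\<close> and \<open>M\<^sub>1\<close> come with a factor \<open>n(n - 1)/2\<close>, the sum still fits
  under \<open>2 n\<^sup>2 M\<^sub>1(c - 1)\<close>.
\<close>

section \<open>Sparse sets over a fixed edge set\<close>

text \<open>Vertex set and edge set are kept separate, so that passing to a smaller vertex set
  leaves \<open>E\<close> unchanged and no induced graph has to be formed.\<close>

definition nbrs :: "'a set set \<Rightarrow> 'a set \<Rightarrow> 'a \<Rightarrow> 'a set" where
  "nbrs E S v = {w \<in> S. {v, w} \<in> E}"

definition sparse :: "nat \<Rightarrow> 'a set set \<Rightarrow> 'a set \<Rightarrow> bool" where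
  "sparse d E S \<longleftrightarrow> (\<forall>v\<in>S. card (nbrs E S v) \<le> d)"

text \<open>Testing single-vertex extensions amounts to inclusion-maximality because
  \<open>sparse\<close> is hereditary on finite sets.\<close>

definition maximal_sparse :: "nat \<Rightarrow> 'a set set \<Rightarrow> 'a set \<Rightarrow> 'a set set" where
  "maximal_sparse d E W =
     {S. S \<subseteq> W \<and> sparse d E S \<and> (\<forall>x\<in>W - S. \<not> sparse d E (insert x S))}"

definition indep :: "'a set set \<Rightarrow> 'a set \<Rightarrow> bool" where
  "indep E S \<longleftrightarrow> (\<forall>u\<in>S. \<forall>v\<in>S. {u, v} \<notin> E)"

text \<open>For adjacent \<open>u\<close>, \<open>v\<close> in the complement of a graph, these are
  their common neighbors in that graph, which is what closedness bounds.\<close>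

definition nonnbrs :: "'a set set \<Rightarrow> 'a set \<Rightarrow> 'a \<Rightarrow> 'a \<Rightarrow> 'a set" where
  "nonnbrs E V u v = {z \<in> V - {u, v}. {u, z} \<notin> E \<and> {v, z} \<notin> E}"

lemma nbrs_mono: "S \<subseteq> T \<Longrightarrow> nbrs E S v \<subseteq> nbrs E T v"
  by (auto simp: nbrs_def)

lemma finite_nbrs: "finite S \<Longrightarrow> finite (nbrs E S v)"
  by (simp add: nbrs_def)

lemma sparse_subset:
  assumes "sparse d E T" "S \<subseteq> T" "finite T"
  shows "sparse d E S"
  unfolding sparse_def
proof
  fix v assume "v \<in> S"
  have "card (nbrs E S v) \<le> card (nbrs E T v)"
    using assms by (intro card_mono finite_nbrs nbrs_mono)
  also have "\<dots> \<le> d"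
    using assms \<open>v \<in> S\<close> by (auto simp: sparse_def)
  finally show "card (nbrs E S v) \<le> d" .
qed

lemma max_degree_le_induced: "max_degree_le d (induced G S) \<longleftrightarrow> sparse d (edges G) S"
proof -
  have "neighbors (induced G S) v = nbrs (edges G) S v" if "v \<in> S" for v
    using that by (auto simp: neighbors_def induced_def nbrs_def)
  then show ?thesis
    by (auto simp: max_degree_le_def sparse_def induced_def)
qed

lemma maximal_sets_eq:
  assumes "finite (verts G)"
  shows "maximal_sets d G = maximal_sparse d (edges G) (verts G)"
proof -
  have "(\<forall>T. T \<subseteq> verts G \<and> S \<subset> T \<longrightarrow> \<not> sparse d (edges G) T) \<longleftrightarrow>
        (\<forall>x\<in>verts G - S. \<not> sparse d (edges G) (insert x S))" (is "?A \<longleftrightarrow> ?B")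
    if S: "S \<subseteq> verts G" for S
  proof
    assume A: ?A
    show ?B
    proof
      fix x assume "x \<in> verts G - S"
      then have "insert x S \<subseteq> verts G \<and> S \<subset> insert x S" using S by auto
      then show "\<not> sparse d (edges G) (insert x S)" using A by simp
    qed
  next
    assume B: ?B
    show ?A
    proof (intro allI impI notI)
      fix T assume T: "T \<subseteq> verts G \<and> S \<subset> T" "sparse d (edges G) T"
      then obtain x where x: "x \<in> T - S" by blast
      have "finite T" using T(1) assms finite_subset by blast
      moreover have "insert x S \<subseteq> T" using T(1) x by blast
      ultimately have "sparse d (edges G) (insert x S)"
        using sparse_subset[OF T(2)] by blast
      moreover have "x \<in> verts G - S" using T(1) x by blast
      ultimately show False using B by blast
    qed
  qed
  then show ?thesis
    unfolding maximal_sets_def maximal_sparse_def max_degree_le_induced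
    by (intro Collect_cong conj_cong refl)
qed

lemma finite_maximal_sparse: "finite W \<Longrightarrow> finite (maximal_sparse d E W)"
  by (rule finite_subset[of _ "Pow W"]) (auto simp: maximal_sparse_def)

text \<open>A smaller ground set leaves fewer vertices to test for extension.\<close>

lemma maximal_sparse_restrict:
  "S \<in> maximal_sparse d E V \<Longrightarrow> S \<subseteq> W \<Longrightarrow> W \<subseteq> V \<Longrightarrow> S \<in> maximal_sparse d E W"
  by (auto simp: maximal_sparse_def)

text \<open>No edge joins \<open>A\<close> to the rest of \<open>W\<close>, so putting
  \<open>A\<close> back changes no degree outside \<open>A\<close>, while the vertices of
  \<open>A\<close> keep the degrees they have in \<open>S\<close>. Hence an extension of
  \<open>S - A\<close> would extend \<open>S\<close>.\<close>

lemma maximal_sparse_drop: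
  assumes S: "S \<in> maximal_sparse d E W" and "finite W" and A: "A \<subseteq> S"
    and iso: "\<And>a x. a \<in> A \<Longrightarrow> x \<in> W - A \<Longrightarrow> {a, x} \<notin> E"
  shows "S - A \<in> maximal_sparse d E (W - A)"
proof -
  have SW: "S \<subseteq> W" and sp: "sparse d E S" using S by (auto simp: maximal_sparse_def)
  have "finite S" using SW \<open>finite W\<close> finite_subset by blast
  have "sparse d E (insert x S)" if x: "x \<in> W - S" "sparse d E (insert x (S - A))" for x
    unfolding sparse_def
  proof
    fix y assume y: "y \<in> insert x S"
    show "card (nbrs E (insert x S) y) \<le> d"
    proof (cases "y \<in> A")
      case True
      then have "nbrs E (insert x S) y = nbrs E S y"
        using iso[OF True, of x] x A by (auto simp: nbrs_def)
      then show ?thesis using sp True A by (auto simp: sparse_def)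
    next
      case False
      have "{y, a} \<notin> E" if "a \<in> A" for a
        using iso[OF that, of y] y False x SW by (auto simp: insert_commute)
      then have "nbrs E (insert x S) y = nbrs E (insert x (S - A)) y"
        by (auto simp: nbrs_def)
      then show ?thesis using x(2) y False by (auto simp: sparse_def)
    qed
  qed
  moreover have "sparse d E (S - A)"
    using sparse_subset[OF sp _ \<open>finite S\<close>] by auto
  ultimately show ?thesis using S by (auto simp: maximal_sparse_def)
qed

section \<open>Transfer to graphs on naturals\<close>

text \<open>Vertices outside the copy of \<open>W\<close> are isolated, so they lie in every maximal set; this pads
  both \<open>W\<close> and \<open>P\<close> to the prescribed sizes without changing the count.\<close>

lemma card_maximal_sparse_le:
  fixes E :: "'a set set"
  assumes two: "\<And>e. e \<in> E \<Longrightarrow> card e = 2" and "finite W" "P \<subseteq> W"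
    and N: "card (W - P) \<le> N" and p: "card P \<le> p"
  shows "card {S \<in> maximal_sparse d E W. P \<subseteq> S} \<le> max_num_maximal d (N + p) p"
proof -
  obtain f where f: "bij_betw f W {..<card W}"
    using ex_bij_betw_finite_nat[OF \<open>finite W\<close>] atLeast0LessThan by metis
  have inj: "inj_on f W" and fW: "f ` W = {..<card W}"
    using f by (auto simp: bij_betw_def)
  have finP: "finite P" using assms finite_subset by blast
  have cW: "card W = card (W - P) + card P"
    using assms finP by (metis card_Diff_subset card_mono le_add_diff_inverse2)
  define New where "New = {card W..<N + p}"
  \<comment> \<open>The image of \<open>P\<close> is filled up to size \<open>p\<close> with new
    isolated vertices; they fit because \<open>card W - card P \<le> N\<close>.\<close>
  define Q where "Q = f ` P \<union> {card W..<card W + (p - card P)}"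
  define F where "F = (`) f ` {e \<in> E. e \<subseteq> W}"
  define H where "H = ({..<N + p}, F)"
  have le: "card W + (p - card P) \<le> N + p" using cW N p by linarith
  have vH: "verts H = f ` W \<union> New" using le by (auto simp: H_def fW New_def)
  have eH: "edges H = F" by (simp add: H_def)
  have simpleH: "simple_graph H"
    unfolding simple_graph_def
  proof
    show "finite (verts H)" by (simp add: H_def)
    show "edges H \<subseteq> {e. e \<subseteq> verts H \<and> card e = 2}"
    proof
      fix e assume "e \<in> edges H"
      then obtain e' where e': "e' \<in> E" "e' \<subseteq> W" "e = f ` e'" by (auto simp: eH F_def)
      have "card e = card e'"
        using e' inj by (auto intro: card_image inj_on_subset)
      then show "e \<in> {e. e \<subseteq> verts H \<and> card e = 2}"
        using e' two vH by auto
    qed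
  qed
  have fim: "f v \<notin> New" if "v \<in> W" for v
  proof -
    have "f v \<in> {..<card W}" using fW that by blast
    then show ?thesis by (simp add: New_def)
  qed
  have Fiff: "{f v, f w} \<in> F \<longleftrightarrow> {v, w} \<in> E" if "v \<in> W" "w \<in> W" for v w
  proof
    assume "{f v, f w} \<in> F"
    then obtain e where e: "e \<in> E" "e \<subseteq> W" "f ` {v, w} = f ` e" by (auto simp: F_def)
    then have "{v, w} = e" using inj that inj_on_image_eq_iff[of f W "{v, w}" e] by simp
    then show "{v, w} \<in> E" using e by simp
  next
    assume "{v, w} \<in> E"
    then show "{f v, f w} \<in> F" using that by (auto simp: F_def intro!: image_eqI[of _ _ "{v, w}"])
  qed
  have Fnew: "{x, y} \<notin> F" if "x \<in> New" for x y
  proof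
    assume "{x, y} \<in> F"
    then obtain e where "e \<subseteq> W" "{x, y} = f ` e" by (auto simp: F_def)
    then have "x \<in> f ` W" by blast
    then show False using fim that by auto
  qed
  have sp: "sparse d F (f ` S \<union> New) \<longleftrightarrow> sparse d E S" if S: "S \<subseteq> W" for S
  proof -
    have 1: "nbrs F (f ` S \<union> New) x = {}" if "x \<in> New" for x
      using Fnew[OF that] by (auto simp: nbrs_def)
    have 2: "card (nbrs F (f ` S \<union> New) (f v)) = card (nbrs E S v)" if "v \<in> S" for v
    proof -
      have "{f v, y} \<notin> F" if "y \<in> New" for y
        using Fnew[OF that, of "f v"] by (simp add: insert_commute)
      then have "nbrs F (f ` S \<union> New) (f v) = f ` nbrs E S v"
        using Fiff[OF subsetD[OF S that] subsetD[OF S]] by (auto simp: nbrs_def)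
      moreover have "inj_on f (nbrs E S v)"
        using inj S by (auto simp: nbrs_def intro: inj_on_subset)
      ultimately show ?thesis by (simp add: card_image)
    qed
    show ?thesis unfolding sparse_def ball_Un ball_simps using 1 2 by simp
  qed
  let ?g = "\<lambda>S. f ` S \<union> New"
  have "?g S \<in> {T \<in> maximal_sets d H. Q \<subseteq> T}"
    if S: "S \<in> maximal_sparse d E W" "P \<subseteq> S" for S
  proof -
    have SW: "S \<subseteq> W" using S by (auto simp: maximal_sparse_def)
    have "\<not> sparse d F (insert x (?g S))" if x: "x \<in> verts H - ?g S" for x
    proof -
      obtain w where w: "w \<in> W" "x = f w" "w \<notin> S" using x vH by auto
      then have "\<not> sparse d E (insert w S)" using S by (auto simp: maximal_sparse_def)
      then show ?thesis using sp[of "insert w S"] w SW by simp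
    qed
    moreover have "?g S \<subseteq> verts H" using vH SW by auto
    moreover have "sparse d F (?g S)" using sp SW S by (auto simp: maximal_sparse_def)
    moreover have "Q \<subseteq> ?g S" using S le by (auto simp: Q_def New_def)
    ultimately show ?thesis
      using maximal_sets_eq[of H d] by (auto simp: maximal_sparse_def eH) (auto simp: H_def)
  qed
  moreover have "inj_on ?g {S \<in> maximal_sparse d E W. P \<subseteq> S}"
  proof (rule inj_onI)
    fix S T assume S: "S \<in> {S \<in> maximal_sparse d E W. P \<subseteq> S}"
      and T: "T \<in> {S \<in> maximal_sparse d E W. P \<subseteq> S}" and eq: "?g S = ?g T"
    have "S \<subseteq> W" "T \<subseteq> W" using S T by (auto simp: maximal_sparse_def)
    moreover have "f ` S = f ` T"
    proof -
      have "f ` S \<inter> New = {}" "f ` T \<inter> New = {}" using fim \<open>S \<subseteq> W\<close> \<open>T \<subseteq> W\<close> by auto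
      then show ?thesis using eq by blast
    qed
    ultimately show "S = T" using inj inj_on_image_eq_iff by metis
  qed
  moreover have "finite (maximal_sets d H)"
    using maximal_sets_eq[of H d] finite_maximal_sparse[of "verts H"] simpleH
    by (simp add: simple_graph_def)
  ultimately have "card {S \<in> maximal_sparse d E W. P \<subseteq> S} \<le> num_maximal d H Q"
    unfolding num_maximal_def by (intro card_inj_on_le[of ?g]) auto
  also have "\<dots> \<le> max_num_maximal d (N + p) p"
    unfolding max_num_maximal_def
  proof (rule Max_ge)
    show "finite {num_maximal d H P |(H :: nat graph) P.
        simple_graph H \<and> card (verts H) = N + p \<and> P \<subseteq> verts H \<and> card P = p}"
      by (rule max_num_maximal_well_defined) simp
    have "card (f ` P) = card P" using inj assms by (auto intro: card_image inj_on_subset)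
    moreover have "f ` P \<inter> {card W..<card W + (p - card P)} = {}"
    proof -
      have "f ` P \<subseteq> {..<card W}" using fW assms(3) by blast
      then show ?thesis by auto
    qed
    ultimately have "card Q = p" unfolding Q_def using finP p by (simp add: card_Un_disjoint)
    moreover have "Q \<subseteq> verts H" using assms(3) le by (auto simp: Q_def vH New_def)
    ultimately show "num_maximal d H Q \<in> {num_maximal d H P |(H :: nat graph) P.
        simple_graph H \<and> card (verts H) = N + p \<and> P \<subseteq> verts H \<and> card P = p}"
      using simpleH by (intro CollectI exI[of _ H] exI[of _ Q]) (simp add: H_def)
  qed
  finally show ?thesis .
qed

section \<open>Maximal sets containing an edge\<close>

lemma card_le_UN_bound:
  assumes "A \<subseteq> (\<Union>i\<in>I. B i)" "finite I" "\<And>i. i \<in> I \<Longrightarrow> finite (B i) \<and> card (B i) \<le> (M :: nat)"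
  shows "card A \<le> card I * M"
proof -
  have "card A \<le> card (\<Union>i\<in>I. B i)" using assms by (intro card_mono) auto
  also have "\<dots> \<le> (\<Sum>i\<in>I. card (B i))" using assms(2) by (rule card_UN_le)
  also have "\<dots> \<le> card I * M" using sum_bounded_above[of I "\<lambda>i. card (B i)" M] assms by simp
  finally show ?thesis .
qed

text \<open>Lists of a fixed length, repetitions allowed, are counted by a power of the number of
  vertices; the filler \<open>x\<close> covers sets with fewer than \<open>k\<close>
  elements.\<close>

lemma ex_list_padded:
  assumes "finite A" "card A \<le> k"
  shows "\<exists>ys. length ys = k \<and> A \<subseteq> set ys \<and> set ys \<subseteq> insert x A"
proof -
  obtain zs where zs: "set zs = A" "distinct zs" using finite_distinct_list assms by blast
  then have "length zs \<le> k" using assms distinct_card by fastforce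
  then show ?thesis using zs
    by (intro exI[of _ "zs @ replicate (k - length zs) x"]) auto
qed

text \<open>The list \<open>xs\<close> starts with an edge \<open>u\<close>, \<open>v\<close> of
  \<open>S\<close> and covers all neighbors of both in \<open>S\<close>. The rest of
  \<open>S\<close> lies among their common non-neighbors, and \<open>set xs\<close> becomes the
  prescribed set.\<close>

lemma card_with_edge_le:
  fixes E :: "'a set set"
  assumes two: "\<And>e. e \<in> E \<Longrightarrow> card e = 2" and V: "finite V" and "d \<ge> 1"
    and closed: "\<And>u v. u \<in> V \<Longrightarrow> v \<in> V \<Longrightarrow> {u, v} \<in> E \<Longrightarrow> card (nonnbrs E V u v) \<le> K"
  shows "card {S \<in> maximal_sparse d E V. \<not> indep E S}
    \<le> card V ^ (2 * d) * max_num_maximal d (K + 2 * d) (2 * d)"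
proof -
  let ?I = "{xs. set xs \<subseteq> V \<and> length xs = 2 * d \<and> {xs ! 0, xs ! 1} \<in> E}"
  let ?L = "{xs. set xs \<subseteq> V \<and> length xs = 2 * d}"
  let ?M = "max_num_maximal d (K + 2 * d) (2 * d)"
  define B where "B xs = {S \<in> maximal_sparse d E (set xs \<union> nonnbrs E V (xs ! 0) (xs ! 1)).
      set xs \<subseteq> S}" for xs
  have "card {S \<in> maximal_sparse d E V. \<not> indep E S} \<le> card ?I * ?M"
  proof (rule card_le_UN_bound[where B = B])
    show "finite ?I" by (rule finite_subset[OF _ finite_lists_length_eq[OF V, of "2 * d"]]) auto
    show "{S \<in> maximal_sparse d E V. \<not> indep E S} \<subseteq> (\<Union>xs\<in>?I. B xs)"
    proof
      fix S assume "S \<in> {S \<in> maximal_sparse d E V. \<not> indep E S}"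
      then obtain u v where S: "S \<in> maximal_sparse d E V" and uv: "u \<in> S" "v \<in> S" "{u, v} \<in> E"
        by (auto simp: indep_def)
      have SV: "S \<subseteq> V" using S by (auto simp: maximal_sparse_def)
      have finS: "finite S" using SV V finite_subset by blast
      let ?P = "nbrs E S u \<union> nbrs E S v"
      have "u \<noteq> v" using two[OF uv(3)] by auto
      have "card (nbrs E S u) \<le> d" "card (nbrs E S v) \<le> d"
        using S uv by (auto simp: maximal_sparse_def sparse_def)
      then have "card ?P \<le> 2 * d" using card_Un_le[of "nbrs E S u" "nbrs E S v"] by linarith
      \<comment> \<open>The ends of the edge are neighbors of each other, so they are among these
        \<open>2 * d\<close> vertices and leave \<open>2 * d - 2\<close> to list.\<close>
      moreover have "{u, v} \<subseteq> ?P" using uv by (auto simp: nbrs_def insert_commute)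
      ultimately have "card (?P - {u, v}) \<le> 2 * d - 2"
        using \<open>u \<noteq> v\<close> by (subst card_Diff_subset) auto
      then obtain ys where ys: "length ys = 2 * d - 2" "?P - {u, v} \<subseteq> set ys"
          "set ys \<subseteq> insert u (?P - {u, v})"
        using ex_list_padded[of "?P - {u, v}" "2 * d - 2" u] finite_nbrs[OF finS] by auto
      let ?xs = "u # v # ys"
      \<comment> \<open>The filler is \<open>u\<close>, which is in \<open>S\<close>
        already.\<close>
      have "set ?xs \<subseteq> S" using ys uv by (auto simp: nbrs_def)
      moreover have "S \<subseteq> set ?xs \<union> nonnbrs E V u v"
        using ys(2) SV by (auto simp: nbrs_def nonnbrs_def)
      moreover have "set ?xs \<union> nonnbrs E V u v \<subseteq> V"
        using \<open>set ?xs \<subseteq> S\<close> SV by (auto simp: nonnbrs_def)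
      ultimately have "S \<in> B ?xs"
        using maximal_sparse_restrict[OF S] by (simp add: B_def)
      moreover have "?xs \<in> ?I" using ys(1) \<open>d \<ge> 1\<close> \<open>set ?xs \<subseteq> S\<close> SV uv by auto
      ultimately show "S \<in> (\<Union>xs\<in>?I. B xs)" by blast
    qed
    fix xs assume xs: "xs \<in> ?I"
    let ?Z = "nonnbrs E V (xs ! 0) (xs ! 1)"
    have "xs ! 0 \<in> V" "xs ! 1 \<in> V" using xs \<open>d \<ge> 1\<close> nth_mem by auto
    then have "card ?Z \<le> K" using xs by (intro closed) auto
    moreover have fin: "finite ?Z" using V by (simp add: nonnbrs_def)
    ultimately have "card (set xs \<union> ?Z - set xs) \<le> K"
      by (metis Diff_subset Un_Diff Diff_cancel sup_bot_left card_mono le_trans)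
    moreover have "card (set xs) \<le> 2 * d" using xs card_length[of xs] by simp
    ultimately show "finite (B xs) \<and> card (B xs) \<le> ?M"
      unfolding B_def using two fin
      by (auto intro!: card_maximal_sparse_le finite_maximal_sparse)
  qed
  also have "\<dots> \<le> card ?L * ?M"
    using finite_lists_length_eq[OF V, of "2 * d"] by (intro mult_right_mono card_mono) auto
  also have "card ?L = card V ^ (2 * d)" using card_lists_length_eq[OF V] by simp
  finally show ?thesis .
qed

text \<open>For \<open>d = 1\<close> the edge is a connected component of \<open>S\<close>, so it
  can be deleted and nothing has to be prescribed. An unordered pair then determines
  \<open>S\<close> up to a maximal set of the common non-neighbors.\<close>

lemma card_with_edge_le_1:
  fixes E :: "'a set set"
  assumes two: "\<And>e. e \<in> E \<Longrightarrow> card e = 2" and V: "finite V"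
    and closed: "\<And>u v. u \<in> V \<Longrightarrow> v \<in> V \<Longrightarrow> {u, v} \<in> E \<Longrightarrow> card (nonnbrs E V u v) \<le> K"
  shows "card {S \<in> maximal_sparse 1 E V. \<not> indep E S}
    \<le> (card V choose 2) * max_num_maximal 1 K 0"
proof -
  let ?I = "{e. e \<subseteq> V \<and> card e = 2} \<inter> E"
  let ?M = "max_num_maximal 1 K 0"
  define Z where "Z e = {z \<in> V - e. \<forall>u\<in>e. {u, z} \<notin> E}" for e
  define B where "B e = (\<union>) e ` maximal_sparse 1 E (Z e)" for e
  have Z: "Z {u, v} = nonnbrs E V u v" for u v by (auto simp: Z_def nonnbrs_def)
  have finZ: "finite (Z e)" for e using V by (simp add: Z_def)
  have "card {S \<in> maximal_sparse 1 E V. \<not> indep E S} \<le> card ?I * ?M"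
  proof (rule card_le_UN_bound[where B = B])
    show "finite ?I" using V by auto
    show "{S \<in> maximal_sparse 1 E V. \<not> indep E S} \<subseteq> (\<Union>e\<in>?I. B e)"
    proof
      fix S assume "S \<in> {S \<in> maximal_sparse 1 E V. \<not> indep E S}"
      then obtain u v where S: "S \<in> maximal_sparse 1 E V" and uv: "u \<in> S" "v \<in> S" "{u, v} \<in> E"
        by (auto simp: indep_def)
      have SV: "S \<subseteq> V" using S by (auto simp: maximal_sparse_def)
      have finS: "finite S" using SV V finite_subset by blast
      have only: "nbrs E S x = {y}" if "x \<in> S" "y \<in> S" "{x, y} \<in> E" for x y
      proof -
        have "card (nbrs E S x) \<le> card {y}"
          using S that by (auto simp: maximal_sparse_def sparse_def)
        moreover have "{y} \<subseteq> nbrs E S x" using that by (auto simp: nbrs_def)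
        ultimately show ?thesis using card_seteq[OF finite_nbrs[OF finS]] by metis
      qed
      have "nbrs E S u = {v}" "nbrs E S v = {u}"
        using only uv by (auto simp: insert_commute)
      then have "S \<subseteq> {u, v} \<union> Z {u, v}"
        using SV by (auto simp: Z_def nbrs_def)
      moreover have "{u, v} \<union> Z {u, v} \<subseteq> V" using SV uv by (auto simp: Z_def)
      ultimately have "S \<in> maximal_sparse 1 E ({u, v} \<union> Z {u, v})"
        using maximal_sparse_restrict[OF S] by blast
      then have "S - {u, v} \<in> maximal_sparse 1 E ({u, v} \<union> Z {u, v} - {u, v})"
        using uv finZ V
        by (intro maximal_sparse_drop) (auto simp: Z_def)
      moreover have "{u, v} \<union> Z {u, v} - {u, v} = Z {u, v}" by (auto simp: Z_def)
      moreover have "S = {u, v} \<union> (S - {u, v})" using uv by auto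
      ultimately have "S \<in> B {u, v}" unfolding B_def by (metis image_eqI)
      moreover have "{u, v} \<in> ?I" using uv SV two[OF uv(3)] by auto
      ultimately show "S \<in> (\<Union>e\<in>?I. B e)" by blast
    qed
    fix e assume e: "e \<in> ?I"
    then obtain u v where uv: "e = {u, v}" by (auto simp: card_2_iff)
    have "card (Z e) \<le> K" using e closed unfolding uv Z by auto
    then have "card {S \<in> maximal_sparse 1 E (Z e). {} \<subseteq> S} \<le> max_num_maximal 1 (K + 0) 0"
      using two finZ by (intro card_maximal_sparse_le) auto
    then have "card (maximal_sparse 1 E (Z e)) \<le> ?M" by simp
    then show "finite (B e) \<and> card (B e) \<le> ?M"
      unfolding B_def using finite_maximal_sparse[OF finZ] card_image_le le_trans by blast
  qed
  also have "\<dots> \<le> card {e. e \<subseteq> V \<and> card e = 2} * ?M"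
    using V by (intro mult_right_mono card_mono) auto
  also have "card {e. e \<subseteq> V \<and> card e = 2} = card V choose 2" using n_subsets[OF V] by simp
  finally show ?thesis .
qed

section \<open>Independent maximal sets\<close>

text \<open>If \<open>v\<close> in \<open>S\<close> were not adjacent to \<open>w\<close>, returning
  it to \<open>insert w (S - {v})\<close> would give no other vertex a new neighbor, as
  \<open>S\<close> is independent, and \<open>v\<close> would have no more neighbors than in
  \<open>S\<close>. Then \<open>w\<close> would already extend \<open>S\<close>.\<close>

lemma adjacent_if_only_delete_extends:
  assumes "finite S" "indep E S" "w \<notin> S" and sp: "sparse d E S"
    and ext: "sparse d E (insert w (S - {v}))" and non: "\<not> sparse d E (insert w S)"
  shows "{v, w} \<in> E"
proof (rule ccontr)
  assume nadj: "{v, w} \<notin> E"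
  have "card (nbrs E (insert w S) y) \<le> d" if y: "y \<in> insert w S" for y
  proof (cases "y = v")
    case True
    then have "nbrs E (insert w S) y = nbrs E S y" if "v \<in> S" using nadj by (auto simp: nbrs_def)
    then show ?thesis using True y sp ext nadj
      by (cases "v \<in> S") (auto simp: sparse_def)
  next
    case False
    have "{y, v} \<notin> E" if "v \<in> S"
      using nadj y \<open>indep E S\<close> that by (auto simp: indep_def insert_commute)
    then have "nbrs E (insert w S) y = nbrs E (insert w (S - {v})) y"
      by (auto simp: nbrs_def)
    then show ?thesis using ext y False by (auto simp: sparse_def)
  qed
  then show False using non by (auto simp: sparse_def)
qed

text \<open>Delete a vertex \<open>v\<close>. Either \<open>S - {v}\<close> is still maximal, or some \<open>w\<close> can be added to it; then
  \<open>w\<close> is adjacent to \<open>v\<close> and has at most \<open>d\<close> further neighbours in \<open>S\<close>, and all other vertices of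
  \<open>S\<close> are non-neighbours of both \<open>v\<close> and \<open>w\<close>.\<close>

lemma card_indep_le:
  fixes E :: "'a set set"
  assumes two: "\<And>e. e \<in> E \<Longrightarrow> card e = 2" and V: "finite V"
    and closed: "\<And>u v. u \<in> V \<Longrightarrow> v \<in> V \<Longrightarrow> {u, v} \<in> E \<Longrightarrow> card (nonnbrs E V u v) \<le> K"
  shows "card {S \<in> maximal_sparse d E V. indep E S}
    \<le> 1 + (\<Sum>i<card V. i ^ Suc d) * max_num_maximal d (K + d) d"
  using V closed
proof (induction V rule: finite_induct)
  case empty
  have "{S \<in> maximal_sparse d E {}. indep E S} \<subseteq> {{}}" by (auto simp: maximal_sparse_def)
  then have "card {S \<in> maximal_sparse d E {}. indep E S} \<le> card {{} :: 'a set}"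
    by (intro card_mono) auto
  then show ?case by simp
next
  case (insert v W)
  let ?M = "max_num_maximal d (K + d) d"
  let ?J = "\<lambda>W. {S \<in> maximal_sparse d E W. indep E S}"
  define X where "X = {S \<in> ?J (insert v W). S - {v} \<in> ?J W}"
  define Y where "Y = {S \<in> ?J (insert v W). S - {v} \<notin> ?J W}"
  have IH: "card (?J W) \<le> 1 + (\<Sum>i<card W. i ^ Suc d) * ?M"
  proof (rule insert.IH)
    fix u w assume "u \<in> W" "w \<in> W" "{u, w} \<in> E"
    then have "card (nonnbrs E (insert v W) u w) \<le> K" by (intro insert.prems) auto
    moreover have "card (nonnbrs E W u w) \<le> card (nonnbrs E (insert v W) u w)"
      using insert.hyps by (intro card_mono) (auto simp: nonnbrs_def)
    ultimately show "card (nonnbrs E W u w) \<le> K" by simp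
  qed
  \<comment> \<open>Two sets of \<open>X\<close> with the same image differ at most in
    \<open>v\<close>; if they differed, one would extend the other, against maximality.\<close>
  have "inj_on (\<lambda>S. S - {v}) X"
  proof (rule inj_onI)
    have one: "v \<notin> T" if "S \<in> X" "T \<in> X" "S - {v} = T - {v}" "v \<notin> S" for S T
    proof
      assume "v \<in> T"
      then have "T = insert v S" using that by auto
      then have "sparse d E (insert v S)" using that(2) by (simp add: X_def maximal_sparse_def)
      then show False using that(1,4) by (simp add: X_def maximal_sparse_def)
    qed
    fix S T assume ST: "S \<in> X" "T \<in> X" "S - {v} = T - {v}"
    then have "v \<in> S \<longleftrightarrow> v \<in> T" using one[OF ST] one[OF ST(2,1) ST(3)[symmetric]] by blast
    then show "S = T" using ST(3) by blast
  qed
  then have cX: "card X \<le> card (?J W)"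
    using insert.hyps finite_maximal_sparse[of W d E]
    by (intro card_inj_on_le[of "\<lambda>S. S - {v}"]) (auto simp: X_def)
  let ?L = "{ds. set ds \<subseteq> W \<and> length ds = d}"
  \<comment> \<open>Here \<open>w\<close> is the vertex that can be added once \<open>v\<close> is
    deleted, and \<open>ds\<close> lists the neighbors of \<open>w\<close> in
    \<open>S - {v}\<close>.\<close>
  let ?I = "{w \<in> W. {v, w} \<in> E} \<times> ?L"
  define Z where "Z w = nonnbrs E (insert v W) v w" for w
  \<comment> \<open>The list may be filled up with \<open>w\<close> itself; since \<open>w\<close>
    is outside \<open>S\<close>, it is removed before the entries are prescribed.\<close>
  define B where "B = (\<lambda>(w, ds). insert v `
     {R \<in> maximal_sparse d E ((set ds - {w}) \<union> Z w). set ds - {w} \<subseteq> R})"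
  have finZ: "finite (Z w)" for w using insert.hyps by (simp add: Z_def nonnbrs_def)
  have finL: "finite ?L" using finite_lists_length_eq[OF insert.hyps(1)] by simp
  have "card Y \<le> card ?I * ?M"
  proof (rule card_le_UN_bound[where B = B])
    show "finite ?I" using insert.hyps finL by auto
    show "Y \<subseteq> (\<Union>i\<in>?I. B i)"
    proof
      fix S assume "S \<in> Y"
      then have S: "S \<in> maximal_sparse d E (insert v W)" and ind: "indep E S"
        and notW: "S - {v} \<notin> ?J W" by (auto simp: Y_def)
      have SW: "S \<subseteq> insert v W" and sp: "sparse d E S"
        using S by (auto simp: maximal_sparse_def)
      have finS: "finite S" using SW insert.hyps finite_subset by blast
      have "indep E (S - {v})" using ind by (auto simp: indep_def)
      then have nmax: "S - {v} \<notin> maximal_sparse d E W" using notW by simp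
      have "v \<in> S"
      proof (rule ccontr)
        assume "v \<notin> S"
        then have "S - {v} = S" "S \<subseteq> W" using SW by auto
        then show False using nmax maximal_sparse_restrict[OF S, of W] by auto
      qed
      have "sparse d E (S - {v})" using sparse_subset[OF sp _ finS] by auto
      then obtain w where w: "w \<in> W" "w \<notin> S - {v}" and ext: "sparse d E (insert w (S - {v}))"
        using nmax SW by (auto simp: maximal_sparse_def)
      have "w \<noteq> v" using w insert.hyps by auto
      then have wS: "w \<notin> S" using w by auto
      then have "\<not> sparse d E (insert w S)" using S w by (auto simp: maximal_sparse_def)
      then have vw: "{v, w} \<in> E"
        using adjacent_if_only_delete_extends[OF finS ind wS sp ext] by simp
      let ?D = "nbrs E (S - {v}) w"
      have "card ?D \<le> card (nbrs E (insert w (S - {v})) w)"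
        using finS by (intro card_mono finite_nbrs nbrs_mono) auto
      also have "\<dots> \<le> d" using ext by (auto simp: sparse_def)
      finally obtain ds where ds: "length ds = d" "?D \<subseteq> set ds" "set ds \<subseteq> insert w ?D"
        using ex_list_padded[of ?D d w] finite_nbrs[of "S - {v}"] finS by auto
      have D: "set ds - {w} = ?D" using ds wS by (auto simp: nbrs_def)
      \<comment> \<open>Independence keeps \<open>S\<close> away from neighbors of \<open>v\<close>;
        a vertex of \<open>S\<close> other than \<open>v\<close> that is not adjacent to
        \<open>w\<close> either is in \<open>Z w\<close>.\<close>
      have "S \<subseteq> insert v (?D \<union> Z w)"
        using SW wS ind \<open>v \<in> S\<close> by (auto simp: nbrs_def Z_def nonnbrs_def indep_def)
      moreover have "insert v (?D \<union> Z w) \<subseteq> insert v W"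
        using SW by (auto simp: nbrs_def Z_def nonnbrs_def)
      ultimately have "S \<in> maximal_sparse d E (insert v (?D \<union> Z w))"
        using maximal_sparse_restrict[OF S] by blast
      then have "S - {v} \<in> maximal_sparse d E (insert v (?D \<union> Z w) - {v})"
        using \<open>v \<in> S\<close> finZ finite_nbrs[of "S - {v}"] finS ind
        by (rule_tac maximal_sparse_drop) (auto simp: Z_def nonnbrs_def nbrs_def indep_def)
      moreover have "insert v (?D \<union> Z w) - {v} = ?D \<union> Z w"
        by (auto simp: Z_def nonnbrs_def nbrs_def)
      ultimately have "S - {v} \<in> {R \<in> maximal_sparse d E ((set ds - {w}) \<union> Z w). set ds - {w} \<subseteq> R}"
        unfolding D by (auto simp: nbrs_def)
      moreover have "S = insert v (S - {v})" using \<open>v \<in> S\<close> by auto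
      ultimately have "S \<in> B (w, ds)" unfolding B_def by blast
      moreover have "set ds \<subseteq> W" using ds(3) w SW by (auto simp: nbrs_def)
      ultimately show "S \<in> (\<Union>i\<in>?I. B i)" using w vw ds(1) by blast
    qed
    fix i assume "i \<in> ?I"
    then obtain w ds where i: "i = (w, ds)" "w \<in> W" "{v, w} \<in> E" "set ds \<subseteq> W" "length ds = d"
      by auto
    let ?D = "set ds - {w}"
    let ?R = "{R \<in> maximal_sparse d E (?D \<union> Z w). ?D \<subseteq> R}"
    have "card (?D \<union> Z w - ?D) \<le> card (Z w)" using finZ by (intro card_mono) auto
    also have "\<dots> \<le> K" unfolding Z_def using i by (intro insert.prems) auto
    finally have "card (?D \<union> Z w - ?D) \<le> K" .
    moreover have "card ?D \<le> d"
      using card_length[of ds] card_mono[of "set ds" ?D] i by auto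
    ultimately have "card ?R \<le> ?M" using two finZ by (intro card_maximal_sparse_le) auto
    moreover have "finite ?R" using finite_maximal_sparse[of "?D \<union> Z w" d E] finZ by auto
    ultimately show "finite (B i) \<and> card (B i) \<le> ?M"
      unfolding B_def i by (auto intro: le_trans[OF card_image_le])
  qed
  \<comment> \<open>The vertex \<open>w\<close> and the \<open>d\<close> list entries are each
    chosen among \<open>card W\<close> vertices.\<close>
  also have "card ?I \<le> card W * card W ^ d"
    unfolding card_cartesian_product card_lists_length_eq[OF insert.hyps(1)]
    using insert.hyps by (intro mult_right_mono card_mono) auto
  finally have cY: "card Y \<le> card W ^ Suc d * ?M" by simp
  have "?J (insert v W) = X \<union> Y" by (auto simp: X_def Y_def)
  then have "card (?J (insert v W)) \<le> card X + card Y" by (simp add: card_Un_le)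
  also have "\<dots> \<le> 1 + (\<Sum>i<card W. i ^ Suc d) * ?M + card W ^ Suc d * ?M"
    using cX cY IH by linarith
  also have "\<dots> = 1 + (\<Sum>i<card (insert v W). i ^ Suc d) * ?M"
    using insert.hyps by (simp add: algebra_simps)
  finally show ?case .
qed

section \<open>The Moon--Moser bound\<close>

text \<open>For positive \<open>k\<close> this says k^(1/k) \<le> 3^(1/3). It controls a branching
  into \<open>k\<close> cases that each delete at least \<open>k\<close> vertices; equality at
  \<open>k = 3\<close> corresponds to disjoint triangles.\<close>

lemma cube_le_power3: "k ^ 3 \<le> (3 :: nat) ^ k"
proof -
  consider "k = 0" | "k = 1" | "k = 2" | "k \<ge> 3" by linarith
  then show ?thesis
  proof cases
    case 4
    then show ?thesis
    proof (induction k rule: dec_induct)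
      case (step k)
      \<comment> \<open>The left side is the increment of the cube from \<open>k\<close> to
        \<open>Suc k\<close>.\<close>
      have "3 * k ^ 2 + 3 * k + 1 \<le> 2 * k ^ 3"
      proof -
        have "3 * k ^ 2 \<le> k ^ 3" using step by (simp add: power3_eq_cube power2_eq_square)
        moreover have "3 * k + 1 \<le> k ^ 3"
        proof -
          have "9 * k \<le> k * k * k"
            using mult_le_mono[OF step.hyps(1) step.hyps(1)] by (intro mult_right_mono) auto
          then show ?thesis using step.hyps(1) unfolding power3_eq_cube by linarith
        qed
        ultimately show ?thesis by linarith
      qed
      then have "Suc k ^ 3 \<le> 3 * k ^ 3"
        by (simp add: power3_eq_cube power2_eq_square algebra_simps)
      also have "\<dots> \<le> 3 * 3 ^ k" using step.IH by simp
      finally show ?case by simp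
    qed simp
  qed auto
qed

lemma sparse_0_iff: "finite S \<Longrightarrow> sparse 0 E S \<longleftrightarrow> indep E S"
  unfolding sparse_def indep_def nbrs_def by simp blast

text \<open>Moon and Moser: every maximal independent set meets the closed neighbourhood of a vertex of
  minimum degree. The bound \<open>3 ^ (n / 3)\<close> is stated in cubed form to stay within the naturals.\<close>

lemma card_maximal_indep_cube_le:
  fixes E :: "'a set set"
  assumes two: "\<And>e. e \<in> E \<Longrightarrow> card e = 2" and "finite W"
  shows "card (maximal_sparse 0 E W) ^ 3 \<le> 3 ^ card W"
  using \<open>finite W\<close>
proof (induction W rule: finite_psubset_induct)
  case (psubset W)
  show ?case
  proof (cases "W = {}")
    case True
    then have "maximal_sparse 0 E W \<subseteq> {{}}" by (auto simp: maximal_sparse_def)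
    then have "card (maximal_sparse 0 E W) \<le> card {{} :: 'a set}" by (intro card_mono) auto
    then have "card (maximal_sparse 0 E W) \<le> 1" by simp
    from power_mono[OF this, of 3] show ?thesis using True by simp
  next
    case False
    define N where "N u = insert u (nbrs E W u)" for u
    obtain v where v: "v \<in> W" "\<And>u. u \<in> W \<Longrightarrow> card (N v) \<le> card (N u)"
      using ex_min_if_finite[of "(\<lambda>u. card (N u)) ` W"] False psubset.hyps
      by (metis (no_types, lifting) arg_min_if_finite(1) arg_min_least)
    let ?k = "card (N v)"
    \<comment> \<open>A uniform bound for all branches, attained at one vertex \<open>u\<close>, so
      a single use of the induction hypothesis suffices.\<close>
    define A where "A = Max ((\<lambda>u. card (maximal_sparse 0 E (W - N u))) ` N v)"
    have NW: "N u \<subseteq> W" if "u \<in> W" for u using that by (auto simp: N_def nbrs_def)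
    have finN: "finite (N u)" for u using psubset.hyps by (simp add: N_def nbrs_def)
    have "N v \<noteq> {}" by (simp add: N_def)
    then have "A \<in> (\<lambda>u. card (maximal_sparse 0 E (W - N u))) ` N v"
      unfolding A_def using finN by (intro Max_in) auto
    then obtain u where u: "u \<in> N v" "A = card (maximal_sparse 0 E (W - N u))" by auto
    have uW: "u \<in> W" using u NW v by auto
    have "W - N u \<subset> W" using uW by (auto simp: N_def)
    then have "A ^ 3 \<le> 3 ^ card (W - N u)" using psubset.IH u by simp
    \<comment> \<open>By the choice of \<open>v\<close>, deleting \<open>N u\<close> removes at
      least \<open>?k\<close> vertices.\<close>
    also have "\<dots> \<le> 3 ^ (card W - ?k)"
      using v(2)[OF uW] NW[OF uW] finN by (intro power_increasing) (auto simp: card_Diff_subset)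
    finally have A3: "A ^ 3 \<le> 3 ^ (card W - ?k)" .
    have "card (maximal_sparse 0 E W) \<le> ?k * A"
    proof (rule card_le_UN_bound[where B = "\<lambda>u. insert u ` maximal_sparse 0 E (W - N u)"])
      show "finite (N v)" by (rule finN)
      show "maximal_sparse 0 E W \<subseteq> (\<Union>u\<in>N v. insert u ` maximal_sparse 0 E (W - N u))"
      proof
        fix S assume S: "S \<in> maximal_sparse 0 E W"
        then have SW: "S \<subseteq> W" by (auto simp: maximal_sparse_def)
        have finS: "finite S" using SW psubset.hyps finite_subset by blast
        have ind: "indep E S" using S finS sparse_0_iff by (auto simp: maximal_sparse_def)
        have "\<exists>u\<in>N v. u \<in> S"
        proof (rule ccontr)
          assume none: "\<not> (\<exists>u\<in>N v. u \<in> S)"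
          have "{v} \<notin> E" using two[of "{v}"] by auto
          then have "indep E (insert v S)"
            using ind none SW by (auto simp: indep_def N_def nbrs_def insert_commute)
          then have "sparse 0 E (insert v S)" using finS sparse_0_iff by blast
          then show False using S v(1) none by (auto simp: maximal_sparse_def N_def)
        qed
        then obtain u where u: "u \<in> N v" "u \<in> S" by blast
        have uN: "insert u (W - N u) \<subseteq> W" "S \<subseteq> insert u (W - N u)"
          using u SW ind by (auto simp: N_def nbrs_def indep_def)
        have "S - {u} \<in> maximal_sparse 0 E (insert u (W - N u) - {u})"
          using maximal_sparse_restrict[OF S uN(2,1)] u psubset.hyps
          by (rule_tac maximal_sparse_drop) (auto simp: N_def nbrs_def)
        moreover have "insert u (W - N u) - {u} = W - N u" by (auto simp: N_def)
        moreover have "S = insert u (S - {u})" using u by auto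
        ultimately show "S \<in> (\<Union>u\<in>N v. insert u ` maximal_sparse 0 E (W - N u))"
          using u by (metis UN_I image_eqI)
      qed
      fix u assume u: "u \<in> N v"
      have fin: "finite (maximal_sparse 0 E (W - N u))"
        using psubset.hyps by (intro finite_maximal_sparse) auto
      have "card (maximal_sparse 0 E (W - N u)) \<le> A"
        unfolding A_def using u finN by (intro Max_ge) auto
      then show "finite (insert u ` maximal_sparse 0 E (W - N u)) \<and>
          card (insert u ` maximal_sparse 0 E (W - N u)) \<le> A"
        using fin card_image_le le_trans by blast
    qed
    then have "card (maximal_sparse 0 E W) ^ 3 \<le> (?k * A) ^ 3" by (rule power_mono) simp
    also have "\<dots> = ?k ^ 3 * A ^ 3" by (rule power_mult_distrib)
    also have "\<dots> \<le> 3 ^ ?k * 3 ^ (card W - ?k)" using cube_le_power3 A3 by (rule mult_mono) auto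
    also have "\<dots> = 3 ^ card W"
      using card_mono[OF psubset.hyps(1) NW[OF v(1)]] by (simp flip: power_add)
    finally show ?thesis .
  qed
qed

section \<open>Comparison of M_0 and M_1\<close>

text \<open>\<open>m\<close> is rounded up to \<open>3 * Suc (m div 3)\<close> so that the cube root
  of the Moon--Moser bound is an integer; this accounts for the factor 3.\<close>

lemma max_num_maximal_0_le: "max_num_maximal 0 m 0 \<le> 3 * 3 ^ (m div 3)"
proof -
  let ?A = "{num_maximal 0 H P | (H :: nat graph) P.
            simple_graph H \<and> card (verts H) = m \<and> P \<subseteq> verts H \<and> card P = 0}"
  have "max_num_maximal 0 m 0 \<in> ?A"
    unfolding max_num_maximal_def using max_num_maximal_well_defined[of 0 m 0]
    by (intro Max_in) auto
  then obtain H :: "nat graph" and P where H: "simple_graph H" "card (verts H) = m"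
      "P \<subseteq> verts H" "card P = 0" "max_num_maximal 0 m 0 = num_maximal 0 H P" by auto
  have fin: "finite (verts H)" and two: "\<And>e. e \<in> edges H \<Longrightarrow> card e = 2"
    using H(1) by (auto simp: simple_graph_def)
  have "P = {}" using H fin finite_subset by fastforce
  then have "max_num_maximal 0 m 0 = card (maximal_sparse 0 (edges H) (verts H))"
    using H(5) fin by (simp add: num_maximal_def maximal_sets_eq)
  then have "max_num_maximal 0 m 0 ^ 3 \<le> 3 ^ m"
    using card_maximal_indep_cube_le[OF two fin] H(2) by simp
  also have "\<dots> \<le> 3 ^ (3 * Suc (m div 3))" by (intro power_increasing) auto
  also have "\<dots> = (3 ^ Suc (m div 3)) ^ 3" by (metis power_mult mult.commute)
  finally have "max_num_maximal 0 m 0 \<le> 3 ^ Suc (m div 3)"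
    using power_mono_iff[of "max_num_maximal 0 m 0" "3 ^ Suc (m div 3)" 3] by simp
  then show ?thesis by simp
qed

text \<open>Witness: disjoint triangles \<open>{3j, 3j+1, 3j+2}\<close>, with \<open>f j\<close> the vertex omitted from the
  \<open>j\<close>-th one; the at most two remaining vertices lie in every maximal set.\<close>

lemma max_num_maximal_1_ge: "3 ^ (m div 3) \<le> max_num_maximal 1 m 0"
proof -
  define k where "k = m div 3"
  define E :: "nat set set" where "E = {{x, y} | x y. x \<noteq> y \<and> x div 3 = y div 3}"
  define T where "T f = {x. x < m \<and> (x div 3 < k \<longrightarrow> x mod 3 \<noteq> f (x div 3))}" for f :: "nat \<Rightarrow> nat"
  let ?F = "{..<k} \<rightarrow>\<^sub>E {..<3 :: nat}"
  have Eiff: "{x, y} \<in> E \<longleftrightarrow> x \<noteq> y \<and> x div 3 = y div 3" for x y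
    by (auto simp: E_def doubleton_eq_iff)
  have two: "card e = 2" if "e \<in> E" for e using that by (auto simp: E_def)
  have block: "3 * j + i < m" if "j < k" "i < 3" for i j
    using that by (simp add: k_def)
  have "inj_on T ?F"
  proof (rule inj_onI)
    fix f g assume f: "f \<in> ?F" and g: "g \<in> ?F" and eq: "T f = T g"
    show "f = g"
    proof (rule PiE_ext[OF f g])
      fix j assume j: "j \<in> {..<k}"
      then have "f j < 3" using f by auto
      \<comment> \<open>\<open>f j\<close> is recovered as the residue missing from triangle
        \<open>j\<close>.\<close>
      then have "3 * j + f j \<notin> T f" "3 * j + f j < m"
        using block j by (auto simp: T_def)
      then have "3 * j + f j \<notin> T g" using eq by simp
      then show "f j = g j" using \<open>3 * j + f j < m\<close> \<open>f j < 3\<close> by (auto simp: T_def split: if_splits)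
    qed
  qed
  moreover have "T f \<in> maximal_sparse 1 E {..<m}" if f: "f \<in> ?F" for f
  proof -
    have f3: "f j < 3" if "j < k" for j using f that by auto
    have "card (nbrs E (T f) x) \<le> 1" if x: "x \<in> T f" for x
    proof -
      have "y = z" if "y \<in> nbrs E (T f) x" "z \<in> nbrs E (T f) x" for y z
      proof (cases "x div 3 < k")
        case True
        \<comment> \<open>Both \<open>y\<close> and \<open>z\<close> avoid the residue of
          \<open>x\<close> and the omitted residue \<open>f (x div 3)\<close>; these two differ, so
          only one residue remains.\<close>
        have "x mod 3 < 3" "y mod 3 < 3" "z mod 3 < 3" by auto
        moreover have "x mod 3 \<noteq> f (x div 3)" "y mod 3 \<noteq> f (x div 3)" "z mod 3 \<noteq> f (x div 3)"
          "y div 3 = x div 3" "z div 3 = x div 3" "x \<noteq> y" "x \<noteq> z"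
          using True x that by (auto simp: T_def nbrs_def Eiff)
        moreover from this have "x mod 3 \<noteq> y mod 3" "x mod 3 \<noteq> z mod 3"
          by (metis div_mult_mod_eq)+
        ultimately have "y mod 3 = z mod 3" using f3[OF True] by linarith
        then show ?thesis using \<open>y div 3 = x div 3\<close> \<open>z div 3 = x div 3\<close> by (metis div_mult_mod_eq)
      next
        case False
        \<comment> \<open>Only \<open>3 * k\<close> and \<open>3 * k + 1\<close> can be left over,
          so at most one vertex besides \<open>x\<close> is in question.\<close>
        have xyz: "x < m" "y < m" "z < m" "y div 3 = x div 3" "z div 3 = x div 3"
            "x \<noteq> y" "x \<noteq> z"
          using x that by (auto simp: T_def nbrs_def Eiff)
        have "x div 3 = k" using False div_le_mono[of x m 3] xyz(1) by (simp add: k_def)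
        then have "x = 3 * k + x mod 3" "y = 3 * k + y mod 3" "z = 3 * k + z mod 3"
          using xyz(4,5) by (metis mult_div_mod_eq)+
        moreover have "m = 3 * k + m mod 3" by (simp add: k_def)
        moreover have "m mod 3 < 3" by simp
        ultimately show ?thesis using xyz by linarith
      qed
      moreover have "finite (nbrs E (T f) x)" by (simp add: nbrs_def T_def)
      ultimately show ?thesis by (auto simp: card_le_Suc0_iff_eq)
    qed
    moreover have "\<not> sparse 1 E (insert x (T f))" if x: "x \<in> {..<m} - T f" for x
    proof
      assume sp: "sparse 1 E (insert x (T f))"
      define j where "j = x div 3"
      have j: "j < k" "x mod 3 = f j" using x by (auto simp: T_def j_def)
      \<comment> \<open>The other two vertices of the triangle are both in \<open>T f\<close>, so
        \<open>x\<close> would have degree two.\<close>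
      let ?A = "(\<lambda>i. 3 * j + i) ` ({..<3} - {f j})"
      have "x = 3 * j + f j" using j by (metis j_def mult_div_mod_eq)
      then have "?A \<subseteq> nbrs E (insert x (T f)) x"
        using j block f3 by (auto simp: nbrs_def Eiff T_def)
      moreover have "finite (nbrs E (insert x (T f)) x)" by (simp add: nbrs_def T_def)
      ultimately have "card ?A \<le> card (nbrs E (insert x (T f)) x)" by (simp add: card_mono)
      also have "\<dots> \<le> 1" using sp by (simp add: sparse_def)
      finally show False using f3[OF j(1)] by (simp add: card_image inj_on_def)
    qed
    ultimately show ?thesis by (auto simp: maximal_sparse_def sparse_def T_def)
  qed
  ultimately have "card ?F \<le> card {S \<in> maximal_sparse 1 E {..<m}. {} \<subseteq> S}"
    using finite_maximal_sparse[of "{..<m}" 1 E] by (intro card_inj_on_le[of T]) auto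
  also have "\<dots> \<le> max_num_maximal 1 (m + 0) 0"
    using two by (intro card_maximal_sparse_le) auto
  finally show ?thesis by (simp add: card_PiE k_def)
qed

section \<open>Monotonicity and the final count\<close>

text \<open>The graph without vertices has one maximal set, and padding carries this to all
  sizes.\<close>

lemma max_num_maximal_pos: "1 \<le> max_num_maximal d (N + p) p"
proof -
  have "{{}} = {S \<in> maximal_sparse d ({} :: nat set set) {}. {} \<subseteq> S}"
    by (auto simp: maximal_sparse_def sparse_def)
  then have "1 = card {S \<in> maximal_sparse d ({} :: nat set set) {}. {} \<subseteq> S}"
    by (metis card_1_singleton_iff One_nat_def)
  also have "\<dots> \<le> max_num_maximal d (N + p) p" by (intro card_maximal_sparse_le) auto
  finally show ?thesis .
qed

text \<open>An extremal graph and its prescribed set are both enlarged by \<open>q - p\<close>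
  isolated vertices.\<close>

lemma max_num_maximal_mono:
  assumes "p \<le> q"
  shows "max_num_maximal d (N + p) p \<le> max_num_maximal d (N + q) q"
proof -
  let ?A = "{num_maximal d H P | (H :: nat graph) P.
            simple_graph H \<and> card (verts H) = N + p \<and> P \<subseteq> verts H \<and> card P = p}"
  have "max_num_maximal d (N + p) p \<in> ?A"
    unfolding max_num_maximal_def using max_num_maximal_well_defined[of p "N + p" d]
    by (intro Max_in) auto
  then obtain H :: "nat graph" and P where H: "simple_graph H" "card (verts H) = N + p"
      "P \<subseteq> verts H" "card P = p" "max_num_maximal d (N + p) p = num_maximal d H P" by auto
  have fin: "finite (verts H)" and two: "\<And>e. e \<in> edges H \<Longrightarrow> card e = 2"
    using H(1) by (auto simp: simple_graph_def)
  have "card (verts H - P) \<le> N"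
    using H fin finite_subset by (subst card_Diff_subset) auto
  then show ?thesis
    using card_maximal_sparse_le[OF two fin H(3), where N = N and p = q and d = d] H assms fin
    by (simp add: num_maximal_def maximal_sets_eq)
qed

text \<open>This brings the count of independent sets under \<open>n ^ (2 * d)\<close> for
  \<open>d \<ge> 2\<close>, including the summand 1 left by the empty graph.\<close>

lemma sum_powers_le: "1 \<le> n \<Longrightarrow> 1 + (\<Sum>i<n. i ^ Suc d) \<le> n ^ (d + 2)" for n :: nat
proof (induction n rule: dec_induct)
  case (step n)
  have "1 + (\<Sum>i<Suc n. i ^ Suc d) \<le> n ^ (d + 2) + n ^ Suc d" using step.IH by simp
  also have "\<dots> = n ^ Suc d * Suc n" by (simp add: algebra_simps)
  also have "\<dots> \<le> Suc n ^ Suc d * Suc n" by (intro mult_right_mono power_mono) auto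
  finally show ?case by (simp add: algebra_simps)
qed simp

theorem theorem8:
  fixes G :: "'a graph" and c d n :: nat
  assumes "c \<ge> 1" and "d \<ge> 1"
    and "simple_graph G" and "card (verts G) = n" and "n \<ge> 1"
    and "\<exists>H. simple_graph H \<and> c_closed c H \<and> G = complement H"
  shows "num_maximal d G {} \<le> 2 * n ^ (2 * d) * max_num_maximal d (c - 1 + 2 * d) (2 * d)
    \<and> (d = 1 \<longrightarrow> num_maximal d G {} \<le> 2 * n ^ 2 * max_num_maximal 1 (c - 1) 0)"
proof -
  define E where "E = edges G"
  define V where "V = verts G"
  define K where "K = c - 1"
  have fin: "finite V" and two: "\<And>e. e \<in> E \<Longrightarrow> card e = 2"
    using assms(3) by (auto simp: simple_graph_def E_def V_def)
  have cV: "card V = n" using assms(4) by (simp add: V_def)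
  obtain H where H: "simple_graph H" "c_closed c H" "G = complement H" using assms(6) by blast
  have closed: "card (nonnbrs E V u v) \<le> K" if uv: "u \<in> V" "v \<in> V" "{u, v} \<in> E" for u v
  proof -
    have "nonnbrs E V u v \<subseteq> neighbors H u \<inter> neighbors H v"
      using uv by (auto simp: nonnbrs_def neighbors_def E_def V_def H(3) complement_def card_insert_if)
    moreover have "finite (neighbors H u)" using H(1) by (simp add: simple_graph_def neighbors_def)
    ultimately have "card (nonnbrs E V u v) \<le> card (neighbors H u \<inter> neighbors H v)"
      by (intro card_mono) auto
    also have "\<dots> \<le> K"
    proof -
      have "u \<noteq> v" using two[OF uv(3)] by auto
      moreover have "{u, v} \<notin> edges H" "u \<in> verts H" "v \<in> verts H"
        using uv by (auto simp: E_def V_def H(3) complement_def)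
      ultimately show ?thesis using H(2) unfolding c_closed_def K_def by blast
    qed
    finally show ?thesis .
  qed
  let ?X = "\<lambda>d. {S \<in> maximal_sparse d E V. \<not> indep E S}"
  let ?Y = "\<lambda>d. {S \<in> maximal_sparse d E V. indep E S}"
  have split: "num_maximal d G {} \<le> card (?X d) + card (?Y d)"
  proof -
    have "num_maximal d G {} = card (maximal_sparse d E V)"
      using fin by (simp add: num_maximal_def maximal_sets_eq E_def V_def)
    also have "maximal_sparse d E V = ?X d \<union> ?Y d" by auto
    finally show ?thesis using card_Un_le[of "?X d" "?Y d"] by simp
  qed
  have one: "num_maximal d G {} \<le> 2 * n ^ 2 * max_num_maximal 1 K 0" if "d = 1"
  proof -
    let ?M = "max_num_maximal 1 K 0"
    have M: "1 \<le> ?M" using max_num_maximal_pos[of 1 K 0] by simp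
    have X: "card (?X d) \<le> (n choose 2) * ?M"
      using card_with_edge_le_1[OF two fin closed] cV that by simp
    \<comment> \<open>Since \<open>sparse 0\<close> implies \<open>sparse d\<close>, a vertex that
      extends an independent set to a larger one would also violate maximality for
      \<open>d\<close>.\<close>
    have "?Y d \<subseteq> ?Y 0"
    proof
      fix S assume S: "S \<in> ?Y d"
      then have SV: "S \<subseteq> V" by (auto simp: maximal_sparse_def)
      then have finS: "finite S" using fin finite_subset by blast
      have "sparse d E T" if "sparse 0 E T" for T using that by (auto simp: sparse_def)
      then show "S \<in> ?Y 0" using S sparse_0_iff[OF finS] by (auto simp: maximal_sparse_def)
    qed
    then have "card (?Y d) \<le> card (?Y 0)"
      using finite_maximal_sparse[OF fin, of 0 E] by (intro card_mono) auto
    also have "\<dots> \<le> 1 + (\<Sum>i<n. i) * max_num_maximal 0 K 0"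
      using card_indep_le[OF two fin closed, of 0] cV by simp
    also have "\<dots> \<le> 1 + (n choose 2) * (3 * ?M)"
    proof -
      have "max_num_maximal 0 K 0 \<le> 3 * ?M"
        using max_num_maximal_0_le[of K] max_num_maximal_1_ge[of K] by linarith
      moreover have "(\<Sum>i<n. i) = n choose 2"
        by (cases n) (simp_all add: lessThan_Suc_atMost gauss_sum_nat choose_two mult.commute atLeast0AtMost[symmetric])
      ultimately show ?thesis by simp
    qed
    \<comment> \<open>The sets with an edge contribute \<open>(n choose 2) * ?M\<close>, the
      independent ones three times as much plus 1.\<close>
    finally have "num_maximal d G {} \<le> 1 + 2 * (2 * (n choose 2)) * ?M"
      using split X by simp
    also have "2 * (n choose 2) = n * (n - 1)" by (cases n) (simp_all add: choose_two)
    \<comment> \<open>The difference of \<open>2 * n ^ 2\<close> and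
      \<open>2 * (n * (n - 1))\<close> is \<open>2 * n\<close>, which leaves room for the summand
      1.\<close>
    also have "1 + 2 * (n * (n - 1)) * ?M \<le> 2 * n * ?M + 2 * (n * (n - 1)) * ?M"
      using M \<open>n \<ge> 1\<close> by (simp add: Suc_le_eq)
    also have "\<dots> = 2 * n ^ 2 * ?M"
      using \<open>n \<ge> 1\<close> by (cases n) (simp_all add: power2_eq_square algebra_simps)
    finally show ?thesis .
  qed
  have "num_maximal d G {} \<le> 2 * n ^ (2 * d) * max_num_maximal d (K + 2 * d) (2 * d)"
  proof (cases "d = 1")
    case True
    \<comment> \<open>Here \<open>d + 2\<close> exceeds \<open>2 * d\<close>, so the bound is
      derived from \<open>one\<close> by enlarging the prescribed set.\<close>
    have "max_num_maximal 1 K 0 \<le> max_num_maximal 1 (K + 2) 2"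
      using max_num_maximal_mono[of 0 2 1 K] by simp
    then have "2 * n ^ 2 * max_num_maximal 1 K 0 \<le> 2 * n ^ 2 * max_num_maximal 1 (K + 2) 2"
      by (rule mult_left_mono) simp
    then have "num_maximal d G {} \<le> 2 * n ^ 2 * max_num_maximal 1 (K + 2) 2"
      using one[OF True] by linarith
    then show ?thesis unfolding True by simp
  next
    case False
    let ?M = "max_num_maximal d (K + 2 * d) (2 * d)"
    have X: "card (?X d) \<le> n ^ (2 * d) * ?M"
      using card_with_edge_le[OF two fin \<open>d \<ge> 1\<close> closed] cV by simp
    have "card (?Y d) \<le> 1 + (\<Sum>i<n. i ^ Suc d) * max_num_maximal d (K + d) d"
      using card_indep_le[OF two fin closed, of d] cV by simp
    also have "\<dots> \<le> ?M + (\<Sum>i<n. i ^ Suc d) * ?M"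
      using max_num_maximal_mono[of d "2 * d" d K] max_num_maximal_pos[of d K "2 * d"]
      by (intro add_mono mult_left_mono) auto
    also have "\<dots> = (1 + (\<Sum>i<n. i ^ Suc d)) * ?M" by (simp add: algebra_simps)
    also have "\<dots> \<le> n ^ (d + 2) * ?M" using sum_powers_le[OF \<open>n \<ge> 1\<close>] by (rule mult_right_mono) simp
    also have "\<dots> \<le> n ^ (2 * d) * ?M"
      using False \<open>d \<ge> 1\<close> \<open>n \<ge> 1\<close> by (intro mult_right_mono power_increasing) auto
    finally show ?thesis using split X by linarith
  qed
  then show ?thesis using one by (simp add: K_def)
qed

end
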